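(* Let $0\le\alpha<1$ and let $f(z)=zh(z)\overline{g(z)}\in\mathcal{S}^{*}_{Lh}(\alpha)$, where $h(z)=\exp\left(\sum_{n=1}^\infty a_nz^n\right)$ and $g(z)=\exp\left(\sum_{n=1}^\infty b_nz^n\right)$. Then $$|a_n|\leq 2(1-\alpha)+\frac{1}{n}\quad\text{and}\quad |b_n|\leq 2(1-\alpha)+\frac{2\alpha-1}{n}$$ for all $n\ge1$. The equalities occur if and only if $f$ is one of the functions of the form $\overline{\eta}f_\alpha(\eta z)$, $|\eta|=1$, where $$f_{\alpha}(z)=\frac{z}{1-z}\,\frac{1}{(1-\overline{z})^{2\alpha-1}}\exp\left((1-\alpha)\operatorname{Re}\left(\frac{4z}{1-z}\right)\right).$$
   Context: $\mathbb{D}=\{z\in\mathbb{C}:|z|<1\}$. A log-harmonic mapping on $\mathbb{D}$ is a solution $f$ of $\overline{f_{\overline z}}/\overline{f}=\mu\, f_z/f$ for some analytic $\mu:\mathbb{D}\to\mathbb{C}$ with $|\mu(z)|<1$ on $\mathbb{D}$; $\mu$ is the (second complex) dilatation of $f$. We consider log-harmonic mappings with $\mu(0)=0$ of the form $f(z)=zh(z)\overline{g(z)}$, where $h(z)=\exp\left(\sum_{n\ge1}a_nz^n\right)$ and $g(z)=\exp\left(\sum_{n\ge1}b_nz^n\right)$ are analytic in $\mathbb{D}$ (so $h,g$ are non-vanishing and $h(0)=g(0)=1$). For $0\le\alpha<1$, $\mathcal{S}^{*}_{Lh}(\alpha)$ is the class of univalent log-harmonic mappings $f$ of this form such that $\operatorname{Re}\left(\dfrac{zf_z(z)-\overline{z}f_{\overline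 z}(z)}{f(z)}\right)>\alpha$ for all $z\in\mathbb{D}\setminus\{0\}$ (log-harmonic starlike mappings of order $\alpha$). Powers of $1-\overline z$ are principal. *)

theory Defs
  imports "HOL-Complex_Analysis.Complex_Analysis"
begin

abbreviation unit_disc :: "complex set" where
  "unit_disc \<equiv> ball 0 1"

text \<open>Wirtinger derivatives \<open>f\<^sub>z = (f\<^sub>x - \<i> f\<^sub>y) / 2\<close> and \<open>f\<^sub>z\<^sub>b\<^sub>a\<^sub>r = (f\<^sub>x + \<i> f\<^sub>y) / 2\<close>; the partial derivatives
  are the values of the real Frechet derivative at \<open>1\<close> and \<open>\<i>\<close>.\<close>

definition wirtinger_z :: "(complex \<Rightarrow> complex) \<Rightarrow> complex \<Rightarrow> complex" where
  "wirtinger_z f z =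
     (frechet_derivative f (at z) 1 - \<i> * frechet_derivative f (at z) \<i>) / 2"

definition wirtinger_zbar :: "(complex \<Rightarrow> complex) \<Rightarrow> complex \<Rightarrow> complex" where
  "wirtinger_zbar f z =
     (frechet_derivative f (at z) 1 + \<i> * frechet_derivative f (at z) \<i>) / 2"

text \<open>The equation has \<open>f z\<close> in the denominators, so it is required only where \<open>f z \<noteq> 0\<close>.\<close>

definition log_harmonic_with_dilatation ::
    "(complex \<Rightarrow> complex) \<Rightarrow> (complex \<Rightarrow> complex) \<Rightarrow> bool" where
  "log_harmonic_with_dilatation f \<mu> \<longleftrightarrow>
     \<mu> holomorphic_on unit_disc \<and> (\<forall>z\<in>unit_disc. norm (\<mu> z) < 1) \<and>
     (\<forall>z\<in>unit_disc. f differentiable (at z)) \<and>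
     (\<forall>z\<in>unit_disc. f z \<noteq> 0 \<longrightarrow>
        cnj (wirtinger_zbar f z) / cnj (f z) = \<mu> z * (wirtinger_z f z / f z))"

text \<open>\<open>h(z) = exp (\<Sum>\<^sub>n\<^sub>\<ge>\<^sub>1 a\<^sub>n z\<^sup>n)\<close> on the disc, the series being convergent there;
  \<open>a 0\<close> is not used.\<close>

definition exp_series_on_disc :: "(complex \<Rightarrow> complex) \<Rightarrow> (nat \<Rightarrow> complex) \<Rightarrow> bool" where
  "exp_series_on_disc h a \<longleftrightarrow>
     (\<forall>z\<in>unit_disc. summable (\<lambda>n. a (Suc n) * z ^ Suc n) \<and>
                     h z = exp (\<Sum>n. a (Suc n) * z ^ Suc n))"

definition log_harmonic_starlike :: "real \<Rightarrow> (complex \<Rightarrow> complex) set" where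
  "log_harmonic_starlike \<alpha> =
     {f. inj_on f unit_disc \<and>
         (\<exists>\<mu>. log_harmonic_with_dilatation f \<mu> \<and> \<mu> 0 = 0) \<and>
         (\<exists>h g a b. exp_series_on_disc h a \<and> exp_series_on_disc g b \<and>
                    (\<forall>z\<in>unit_disc. f z = z * h z * cnj (g z))) \<and>
         (\<forall>z\<in>unit_disc - {0}.
            Re ((z * wirtinger_z f z - cnj z * wirtinger_zbar f z) / f z) > \<alpha>)}"

definition extremal_log_harmonic :: "real \<Rightarrow> complex \<Rightarrow> complex" where
  "extremal_log_harmonic \<alpha> z =
     z / (1 - z) * (1 / (1 - cnj z) powr complex_of_real (2 * \<alpha> - 1)) *
     complex_of_real (exp ((1 - \<alpha>) * Re (4 * z / (1 - z))))"

definition is_rotated_extremal :: "real \<Rightarrow> (complex \<Rightarrow> complex) \<Rightarrow> bool" where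
  "is_rotated_extremal \<alpha> f \<longleftrightarrow>
     (\<exists>\<eta>. norm \<eta> = 1 \<and> (\<forall>z\<in>unit_disc. f z = cnj \<eta> * extremal_log_harmonic \<alpha> (\<eta> * z)))"

end

theory Submission
  imports Defs
begin

text \<open>With \<open>A = 1 + z h'/h\<close> and \<open>B = z g'/g\<close>, whose Taylor coefficients are \<open>n a\<^sub>n\<close> and \<open>n b\<^sub>n\<close>,
  the log-harmonic equation reads \<open>B = \<mu> A\<close> and starlikeness reads \<open>Re (A - B) > \<alpha>\<close>. Hence
  \<open>A = p q\<close> and \<open>B = p q - p\<close>, where \<open>p = A - B\<close> and \<open>q = 1 / (1 - \<mu>)\<close> have value \<open>1\<close> at \<open>0\<close> and satisfy
  \<open>Re p > \<alpha>\<close> and \<open>Re q > 1/2\<close> (lemma \<open>starlike_coefficients_convolution\<close>). By Caratheodory's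
  inequality (lemma \<open>caratheodory_order_coeff\<close>) the coefficients satisfy \<open>\<bar>p\<^sub>k\<bar> \<le> 2 (1 - \<alpha>)\<close> and \<open>\<bar>q\<^sub>k\<bar> \<le> 1\<close>,
  and the triangle inequality applied to the convolution \<open>\<Sum> p\<^sub>k q\<^sub>n\<^sub>-\<^sub>k\<close>, which runs up to \<open>n\<close> for
  \<open>A\<close> and up to \<open>n - 1\<close> for \<open>B\<close>, gives the two bounds.

  Equality for one index (at least \<open>2\<close> in the case of \<open>b\<close>) forces \<open>p\<^sub>1\<close> and \<open>q\<^sub>1\<close> to be extremal
  (lemma \<open>convolution_norm_le\<close>). The equality case of the Schwarz lemma then makes both coefficient
  sequences geometric, and since all terms of the convolution have the same argument, the ratios are
  the same number \<open>\<eta>\<close> of modulus \<open>1\<close>. So all \<open>a\<^sub>n\<close> and \<open>b\<^sub>n\<close> are known, and summing the series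
  gives the rotation by \<open>\<eta>\<close> of the extremal mapping.

  Conversely, the factors of the extremal mapping have coefficients of the asserted moduli. To
  transfer this to the given series \<open>a\<close> and \<open>b\<close> one needs that the mapping determines
  its coefficients (lemma \<open>coefficients_unique\<close>).\<close>

section \<open>Power series on the unit disc\<close>

lemma powser_on_disc:
  fixes c :: "nat \<Rightarrow> complex"
  assumes sums: "\<And>z. norm z < 1 \<Longrightarrow> (\<lambda>n. c n * z ^ n) sums f z"
  shows "f holomorphic_on unit_disc" and "f has_fps_expansion Abs_fps c"
proof -
  have "f has_fps_expansion Abs_fps c \<and> f holomorphic_on unit_disc"
  proof
    have "eventually (\<lambda>u. u \<in> unit_disc) (nhds (0::complex))"
      by (intro eventually_nhds_in_open) auto
    then show exp: "f has_fps_expansion Abs_fps c"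
      by (intro has_fps_expansionI) (auto elim!: eventually_mono intro: sums)
    have "norm z < fps_conv_radius (Abs_fps c)" if z: "norm z < 1" for z :: complex
    proof -
      obtain r where r: "norm z < r" "r < 1"
        using dense[OF z] by blast
      then have "norm (complex_of_real r) < 1"
        using norm_ge_zero[of z] by (simp del: norm_ge_zero)
      then have "conv_radius c \<ge> norm (complex_of_real r)"
        by (intro conv_radius_geI sums_summable[OF sums])
      moreover have "ereal (norm z) < ereal (norm (complex_of_real r))"
        using r norm_ge_zero[of z] by (simp del: norm_ge_zero)
      ultimately have "ereal (norm z) < conv_radius c"
        by (rule less_le_trans[rotated])
      then show ?thesis
        by (simp add: fps_conv_radius_def)
    qed
    then have "eval_fps (Abs_fps c) holomorphic_on unit_disc"
      by (intro holomorphic_on_eval_fps) (auto simp: in_eball_iff)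
    moreover have "f z = eval_fps (Abs_fps c) z" if "z \<in> unit_disc" for z
      using sums[of z] that by (simp add: eval_fps_def sums_iff)
    ultimately show "f holomorphic_on unit_disc"
      using holomorphic_cong by blast
  qed
  then show "f holomorphic_on unit_disc" "f has_fps_expansion Abs_fps c"
    by auto
qed

text \<open>A formal expansion is a statement about germs at \<open>0\<close>; holomorphy on the whole disc is what makes
the same series converge everywhere on it.\<close>
lemma has_fps_expansion_imp_sums_disc:
  assumes "f has_fps_expansion F" "f holomorphic_on unit_disc" "norm z < 1"
  shows "(\<lambda>n. fps_nth F n * z ^ n) sums f z"
proof -
  have "eball (0::complex) 1 = unit_disc"
    by (auto simp: in_eball_iff one_ereal_def)
  then show ?thesis
    using has_fps_expansion_imp_sums_complex[of f F 1 z] assms by (simp add: one_ereal_def)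
qed

section \<open>Functions with positive real part\<close>

text \<open>The Cayley transform \<open>W = (p - 1) / (p + 1)\<close> turns the right half-plane into the disc, so the
Schwarz lemma applies to \<open>W\<close>; the coefficient in question is \<open>2 W'(0)\<close>, and the rigidity part of the
Schwarz lemma determines \<open>p\<close> in the extremal case.\<close>
lemma caratheodory_first_coeff:
  assumes hol: "p holomorphic_on unit_disc" and p0: "p 0 = 1"
    and pos: "\<And>z. norm z < 1 \<Longrightarrow> Re (p z) > 0"
  shows "norm (deriv p 0) \<le> 2"
    and "norm (deriv p 0) = 2 \<Longrightarrow>
           \<exists>e. norm e = 1 \<and> (\<forall>z. norm z < 1 \<longrightarrow> p z = (1 + e * z) / (1 - e * z))"
proof -
  define W where "W z = (p z - 1) / (p z + 1)" for z
  have nz: "p z + 1 \<noteq> 0" if "norm z < 1" for z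
    using pos[OF that] by (auto simp: complex_eq_iff)
  have holW: "W holomorphic_on unit_disc"
    unfolding W_def by (intro holomorphic_intros hol) (use nz in auto)
  have W0: "W 0 = 0"
    by (simp add: W_def p0)
  have W1: "norm (W z) < 1" if "norm z < 1" for z
  proof -
    have "norm (p z - 1)^2 < norm (p z + 1)^2"
      using pos[OF that] unfolding cmod_power2 by (simp add: power2_eq_square algebra_simps)
    then have "norm (p z - 1) < norm (p z + 1)"
      using power_less_imp_less_base by (metis norm_ge_zero)
    then show ?thesis
      unfolding W_def norm_divide using nz[OF that] by simp
  qed
  have "(p has_field_derivative deriv p 0) (at 0)"
    by (intro holomorphic_derivI[OF hol]) auto
  then have "(W has_field_derivative (deriv p 0 * (p 0 + 1) - (p 0 - 1) * deriv p 0) / ((p 0 + 1) * (p 0 + 1))) (at 0)"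
    unfolding W_def by (auto intro!: derivative_eq_intros simp: p0)
  then have dW: "deriv W 0 = deriv p 0 / 2"
    by (simp add: DERIV_imp_deriv p0)
  have "norm (deriv W 0) \<le> 1"
    by (rule Schwarz_Lemma(2)[OF holW W0 W1, of 0]) auto
  then show "norm (deriv p 0) \<le> 2"
    by (simp add: dW norm_divide)
  assume "norm (deriv p 0) = 2"
  then have "norm (deriv W 0) = 1"
    by (simp add: dW norm_divide)
  then obtain e where e: "norm e = 1" "\<And>z. norm z < 1 \<Longrightarrow> W z = e * z"
    using Schwarz_Lemma(3)[OF holW W0 W1, of 0] by auto
  have "p z = (1 + e * z) / (1 - e * z)" if z: "norm z < 1" for z
  proof -
    have "1 - e * z \<noteq> 0"
      using z e(1) by (metis norm_mult mult_1 less_irrefl eq_iff_diff_eq_0 norm_one)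
    moreover have "p z - 1 = e * z * (p z + 1)"
      using e(2)[OF z] nz[OF z] by (simp add: W_def field_simps)
    ultimately show ?thesis
      by (simp add: field_simps)
  qed
  with e show "\<exists>e. norm e = 1 \<and> (\<forall>z. norm z < 1 \<longrightarrow> p z = (1 + e * z) / (1 - e * z))"
    by blast
qed

text \<open>Orthogonality of the characters of \<open>\<int>/n\<int>\<close>: averaging over the \<open>n\<close>-th roots of unity keeps exactly
the terms of a power series whose exponent is a multiple of \<open>n\<close>.\<close>
lemma sum_powers_root_of_unity:
  assumes "n \<ge> 1"
  defines "\<omega> \<equiv> exp (2 * of_real pi * \<i> / of_nat n)"
  shows "(\<Sum>j<n. (\<omega> ^ j) ^ m) = (if n dvd m then of_nat n else 0)"
proof -
  have pw: "\<omega> ^ k = exp (2 * of_real pi * \<i> * of_nat k / of_nat n)" for k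
    unfolding \<omega>_def by (simp add: exp_of_nat_mult[symmetric] mult_ac)
  have eq1: "\<omega> ^ k = 1 \<longleftrightarrow> n dvd k" for k
    using complex_root_unity_eq_1[OF assms(1), of k] by (simp add: pw)
  have eq: "(\<Sum>j<n. (\<omega> ^ j) ^ m) = (\<Sum>j<n. (\<omega> ^ m) ^ j)"
    by (simp add: power_mult[symmetric] mult.commute)
  show ?thesis
  proof (cases "n dvd m")
    case True
    then show ?thesis using eq1[of m] by (simp add: eq)
  next
    case False
    then have "(\<Sum>j<n. (\<omega> ^ m) ^ j) = ((\<omega> ^ m) ^ n - 1) / (\<omega> ^ m - 1)"
      using eq1[of m] by (intro geometric_sum) auto
    also have "(\<omega> ^ m) ^ n = 1"
      using eq1[of "m * n"] by (simp add: power_mult)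
    finally show ?thesis using False by (simp add: eq)
  qed
qed

text \<open>Reduction to the first coefficient: the average of \<open>p (\<omega>\<^sup>j z)\<close> over the \<open>n\<close>-th roots of unity
\<open>\<omega>\<^sup>j\<close> still has positive real part and is a function \<open>Q\<close> of \<open>z\<^sup>n\<close>, with first coefficient
the \<open>n\<close>-th coefficient of \<open>p\<close>.\<close>
lemma caratheodory_coeff:
  assumes hol: "p holomorphic_on unit_disc" and p0: "p 0 = 1"
    and pos: "\<And>z. norm z < 1 \<Longrightarrow> Re (p z) > 0"
    and exp: "p has_fps_expansion P" and n: "n \<ge> 1"
  shows "norm (fps_nth P n) \<le> 2"
proof -
  define \<omega> where "\<omega> = exp (2 * of_real pi * \<i> / of_nat n)"
  define Q where "Q w = (\<Sum>k. fps_nth P (k * n) * w ^ k)" for w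
  have norm_\<omega>: "norm (\<omega> ^ j) = 1" for j
    unfolding \<omega>_def norm_power by (simp add: norm_exp_eq_Re)
  have avg: "(\<lambda>k. fps_nth P (k * n) * (z ^ n) ^ k) sums ((\<Sum>j<n. p (\<omega> ^ j * z)) / of_nat n)"
    if z: "norm z < 1" for z
  proof -
    have "(\<lambda>m. (\<Sum>j<n. fps_nth P m * (\<omega> ^ j * z) ^ m) / of_nat n)
            sums ((\<Sum>j<n. p (\<omega> ^ j * z)) / of_nat n)"
      by (intro sums_divide sums_sum has_fps_expansion_imp_sums_disc exp hol)
         (use z norm_\<omega> in \<open>auto simp: norm_mult\<close>)
    moreover have "(\<Sum>j<n. fps_nth P m * (\<omega> ^ j * z) ^ m) / of_nat n
        = (if n dvd m then fps_nth P m * z ^ m else 0)" for m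
    proof -
      have "(\<Sum>j<n. fps_nth P m * (\<omega> ^ j * z) ^ m) = fps_nth P m * z ^ m * (\<Sum>j<n. (\<omega> ^ j) ^ m)"
        by (simp add: sum_distrib_left power_mult_distrib mult_ac)
      then show ?thesis
        using n by (simp add: sum_powers_root_of_unity \<omega>_def)
    qed
    ultimately have "(\<lambda>m. if n dvd m then fps_nth P m * z ^ m else 0)
            sums ((\<Sum>j<n. p (\<omega> ^ j * z)) / of_nat n)"
      by simp
    moreover have "strict_mono (\<lambda>k. k * n)"
      using n by (simp add: strict_mono_def)
    ultimately show ?thesis
      by (subst (asm) sums_mono_reindex[of "\<lambda>k. k * n", symmetric])
         (auto simp: dvd_def power_mult[symmetric] mult_ac)
  qed
  \<comment> \<open>Every \<open>w\<close> in the disc is \<open>z\<^sup>n\<close> with \<open>z\<close> in the disc, so \<open>Q\<close> is defined on all of it.\<close>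
  have root: "\<exists>z. norm z < 1 \<and> z ^ n = w" if w: "norm w < 1" for w :: complex
  proof -
    have "{z. z ^ n = w} \<noteq> {}"
    proof (cases "w = 0")
      case True
      then show ?thesis using n by (auto intro: exI[of _ 0])
    next
      case False
      then show ?thesis using card_nth_roots[of w n] n by (metis card.empty not_one_le_zero zero_less_iff_neq_zero)
    qed
    then obtain z where z: "z ^ n = w" by blast
    then have "norm z ^ n < 1"
      using w by (metis norm_power)
    then have "norm z < 1"
      by (meson linorder_not_less one_le_power)
    with z show ?thesis by blast
  qed
  have Qsums: "(\<lambda>k. fps_nth P (k * n) * w ^ k) sums Q w" if "norm w < 1" for w
    using root[OF that] avg unfolding Q_def by (metis sums_summable summable_sums)
  note Q = powser_on_disc[of "\<lambda>k. fps_nth P (k * n)" Q, OF Qsums]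
  have P0: "fps_nth P 0 = 1"
    using fps_nth_fps_expansion[OF exp, of 0] p0 by simp
  have "Q 0 = 1"
    using fps_nth_fps_expansion[OF Q(2), of 0] P0 by simp
  moreover have "Re (Q w) > 0" if w: "norm w < 1" for w
  proof -
    obtain z where z: "norm z < 1" "z ^ n = w" using root[OF w] by blast
    have "Q w = (\<Sum>j<n. p (\<omega> ^ j * z)) / of_nat n"
      using sums_unique2[OF Qsums[OF w]] avg[OF z(1)] z(2) by simp
    then have "Re (Q w) = (\<Sum>j<n. Re (p (\<omega> ^ j * z))) / real n"
      by simp
    also have "\<dots> > 0"
      using n z(1) norm_\<omega> by (intro divide_pos_pos sum_pos pos) (auto simp: norm_mult lessThan_empty_iff)
    finally show ?thesis .
  qed
  ultimately have "norm (deriv Q 0) \<le> 2"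
    using caratheodory_first_coeff(1)[OF Q(1)] by blast
  moreover have "deriv Q 0 = fps_nth P n"
    using fps_nth_fps_expansion[OF Q(2), of 1] by simp
  ultimately show ?thesis by simp
qed

text \<open>Rescaling \<open>p\<close> to \<open>(p - \<alpha>) / (1 - \<alpha>)\<close> reduces this to \<open>\<alpha> = 0\<close>. It will be used with the order
\<open>\<alpha>\<close> of starlikeness and, for the factor \<open>1 / (1 - \<mu>)\<close>, with \<open>1/2\<close>. The first coefficient alone
decides extremality: once it is as large as possible, the whole sequence is geometric.\<close>
lemma caratheodory_order_coeff:
  assumes hol: "p holomorphic_on unit_disc" and p0: "p 0 = 1" and \<alpha>: "\<alpha> < 1"
    and pos: "\<forall>z\<in>unit_disc. Re (p z) > \<alpha>"
    and exp: "p has_fps_expansion P"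
  shows "n \<ge> 1 \<Longrightarrow> norm (fps_nth P n) \<le> 2 * (1 - \<alpha>)"
    and "norm (fps_nth P 1) = 2 * (1 - \<alpha>) \<Longrightarrow>
           \<exists>e. norm e = 1 \<and> (\<forall>n\<ge>1. fps_nth P n = of_real (2 * (1 - \<alpha>)) * e ^ n)"
proof -
  define r where "r z = (p z - of_real \<alpha>) * of_real (1 / (1 - \<alpha>))" for z
  define R where "R = (P - fps_const (of_real \<alpha>)) * fps_const (of_real (1 / (1 - \<alpha>)))"
  have K: "(1 - of_real \<alpha>) * of_real (1 / (1 - \<alpha>)) = (1 :: complex)"
  proof -
    have "complex_of_real ((1 - \<alpha>) * (1 / (1 - \<alpha>))) = 1"
      using \<alpha> by simp
    then show ?thesis by (simp only: of_real_mult of_real_diff of_real_1)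
  qed
  have holr: "r holomorphic_on unit_disc"
    unfolding r_def by (intro holomorphic_intros hol)
  have r0: "r 0 = 1"
    using K by (simp add: r_def p0)
  have rpos: "Re (r z) > 0" if "norm z < 1" for z
  proof -
    have "Re (r z) = (Re (p z) - \<alpha>) * (1 / (1 - \<alpha>))"
      by (simp only: r_def times_complex.sel minus_complex.sel Re_complex_of_real Im_complex_of_real)
    then show ?thesis using pos that \<alpha> by simp
  qed
  have expr: "r has_fps_expansion R"
    unfolding r_def R_def by (intro fps_expansion_intros exp)
  have P: "fps_nth P n = of_real (1 - \<alpha>) * fps_nth R n" if "n \<ge> 1" for n
  proof -
    have "fps_nth R n = fps_nth P n * of_real (1 / (1 - \<alpha>))"
      using that by (simp add: R_def)
    then have "of_real (1 - \<alpha>) * fps_nth R n = fps_nth P n * ((1 - of_real \<alpha>) * of_real (1 / (1 - \<alpha>)))"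
      by (simp only: of_real_diff of_real_1 mult_ac)
    then show ?thesis
      unfolding K by simp
  qed
  have "norm (fps_nth R n) \<le> 2" if "n \<ge> 1" for n
    using caratheodory_coeff[OF holr r0 rpos expr that] by blast
  then show "norm (fps_nth P n) \<le> 2 * (1 - \<alpha>)" if "n \<ge> 1"
    using P[OF that] mult_left_mono[of "norm (fps_nth R n)" 2 "1 - \<alpha>"] that \<alpha>
    by (simp add: norm_mult del: of_real_diff)
  assume "norm (fps_nth P 1) = 2 * (1 - \<alpha>)"
  then have "(1 - \<alpha>) * norm (fps_nth R 1) = (1 - \<alpha>) * 2"
    using P[of 1] \<alpha> by (simp add: norm_mult del: of_real_diff)
  then have "norm (fps_nth R 1) = 2"
    using \<alpha> unfolding mult_cancel_left by linarith
  moreover have "deriv r 0 = fps_nth R 1"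
    using fps_nth_fps_expansion[OF expr, of 1] by simp
  ultimately obtain e where e: "norm e = 1" "\<And>z. norm z < 1 \<Longrightarrow> r z = (1 + e * z) / (1 - e * z)"
    using caratheodory_first_coeff(2)[OF holr r0 rpos] by auto
  have "(\<lambda>n. (if n = 0 then 1 else 2 * e ^ n) * z ^ n) sums r z" if z: "norm z < 1" for z
  proof -
    have ez: "norm (e * z) < 1"
      using z e(1) by (simp add: norm_mult)
    then have "(\<lambda>n. 2 * (e * z) ^ n - (if n = 0 then 1 else 0)) sums (2 * (1 / (1 - e * z)) - 1)"
      by (intro sums_diff sums_mult geometric_sums sums_single[of 0 "\<lambda>_. 1", simplified])
    moreover have "2 * (1 / (1 - e * z)) - 1 = r z"
    proof -
      have "1 - e * z \<noteq> 0"
        using ez by auto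
      then show ?thesis
        unfolding e(2)[OF z] by (simp add: field_simps)
    qed
    moreover have "2 * (e * z) ^ n - (if n = 0 then 1 else 0) = (if n = 0 then 1 else 2 * e ^ n) * z ^ n" for n
      by (simp add: power_mult_distrib)
    ultimately show ?thesis by simp
  qed
  from powser_on_disc(2)[OF this] have "R = Abs_fps (\<lambda>n. if n = 0 then 1 else 2 * e ^ n)"
    using expr fps_expansion_unique_complex by blast
  then have "\<forall>n\<ge>1. fps_nth P n = of_real (2 * (1 - \<alpha>)) * e ^ n"
    using P by simp
  with e(1) show "\<exists>e. norm e = 1 \<and> (\<forall>n\<ge>1. fps_nth P n = of_real (2 * (1 - \<alpha>)) * e ^ n)"
    by blast
qed

section \<open>Extremal convolutions\<close>

text \<open>The equality case of the triangle inequality: every summand has the largest allowed modulus and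
they all point in the direction \<open>u\<close> of the sum.\<close>
lemma norm_sum_eq_bound_imp_aligned:
  fixes x :: "'a \<Rightarrow> complex"
  assumes "finite A" and le: "\<And>k. k \<in> A \<Longrightarrow> norm (x k) \<le> c k"
    and eq: "norm (\<Sum>k\<in>A. x k) = (\<Sum>k\<in>A. c k)"
  obtains u where "norm u = 1" "\<And>k. k \<in> A \<Longrightarrow> x k = of_real (c k) * u"
proof (cases "(\<Sum>k\<in>A. x k) = 0")
  case True
  have "\<And>k. k \<in> A \<Longrightarrow> c k \<ge> 0"
    using le norm_ge_zero order_trans by blast
  then have "\<And>k. k \<in> A \<Longrightarrow> c k = 0"
    using eq True assms(1) by (simp add: sum_nonneg_eq_0_iff)
  then show ?thesis
    using that[of 1] le by force
next
  case False
  define u where "u = sgn (\<Sum>k\<in>A. x k)"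
  have u: "norm u = 1"
    using False by (simp add: u_def norm_sgn)
  then have uu: "cnj u * u = 1"
    by (metis complex_norm_square mult.commute of_real_1 power_one)
  have sum_u: "(\<Sum>k\<in>A. x k) = of_real (norm (\<Sum>k\<in>A. x k)) * u"
    by (simp add: u_def sgn_eq)
  have "(\<Sum>k\<in>A. x k * cnj u) = of_real (norm (\<Sum>k\<in>A. x k))"
    using uu by (subst sum_distrib_right[symmetric], subst sum_u) (simp add: mult_ac)
  then have "(\<Sum>k\<in>A. Re (x k * cnj u)) = (\<Sum>k\<in>A. c k)"
    unfolding eq[symmetric] by (metis Re_complex_of_real Re_sum)
  moreover have le': "Re (x k * cnj u) \<le> c k" if "k \<in> A" for k
    using le[OF that] complex_Re_le_cmod[of "x k * cnj u"] u by (simp add: norm_mult)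
  ultimately have re: "Re (x k * cnj u) = c k" if "k \<in> A" for k
    using sum_mono_inv[OF _ le' that assms(1)] by simp
  have "x k = of_real (c k) * u" if k: "k \<in> A" for k
  proof -
    have "norm (x k * cnj u) \<le> Re (x k * cnj u)"
      using re[OF k] le[OF k] u by (simp add: norm_mult)
    then have "Re (x k * cnj u) = norm (x k * cnj u)"
      using complex_Re_le_cmod order_antisym by blast
    then have "x k * cnj u = of_real (c k)"
      using re[OF k] by (metis Re_complex_of_real complex_eqI complex_is_Real_iff cmod_eq_Re
          Im_complex_of_real cmod_power2 add_cancel_left_right power_eq_0_iff)
    then show ?thesis
      using uu by (metis mult.assoc mult.right_neutral)
  qed
  with u that show ?thesis by blast
qed

text \<open>The truncation index \<open>m\<close> serves both coefficient families: \<open>m = n\<close> for those of \<open>h\<close> and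
\<open>m = n - 1\<close> for those of \<open>g\<close>. In the equality case the summands with index \<open>1\<close> and \<open>n - 1\<close> force
\<open>p 1\<close> and \<open>q 1\<close> to be extremal, and comparing the directions of the summands with index \<open>0\<close> and
\<open>1\<close> links the two sequences. This needs both indices in the range, that is \<open>1 \<le> m\<close>, which is why
the first coefficient of \<open>g\<close> has no rigidity.\<close>
lemma convolution_norm_le:
  fixes p q :: "nat \<Rightarrow> complex"
  assumes p0: "p 0 = 1" and q0: "q 0 = 1"
    and p: "\<forall>k\<ge>1. norm (p k) \<le> c" and q: "\<forall>k\<ge>1. norm (q k) \<le> 1"
    and c: "c > 0"
  shows "norm (\<Sum>k\<le>m. p k * q (n - k)) \<le> 1 + c * real m"
    and "norm (\<Sum>k\<le>m. p k * q (n - k)) = 1 + c * real m \<Longrightarrow> 1 \<le> m \<Longrightarrow> m \<le> n \<Longrightarrow> n \<le> Suc m \<Longrightarrow>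
           norm (p 1) = c \<and> norm (q 1) = 1 \<and> p 1 * q (n - 1) = of_real c * q n"
proof -
  \<comment> \<open>The modulus bound for the summand with index \<open>k\<close>.\<close>
  define b where "b k = (if k = 0 then 1 else c)" for k :: nat
  have q': "norm (q k) \<le> 1" for k
    using q q0 by (cases k) auto
  have "norm (p k) \<le> b k" for k
    using p p0 by (cases k) (auto simp: b_def)
  then have le: "norm (p k * q (n - k)) \<le> b k" for k
    using mult_mono[of "norm (p k)" "b k" "norm (q (n - k))" 1] q' c
    by (simp add: norm_mult b_def split: if_splits)
  have sum_b: "(\<Sum>k\<le>m. b k) = 1 + c * real m"
    by (simp add: sum.atMost_shift b_def)
  show "norm (\<Sum>k\<le>m. p k * q (n - k)) \<le> 1 + c * real m"
    unfolding sum_b[symmetric] by (rule sum_norm_le) (rule le)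
  assume "norm (\<Sum>k\<le>m. p k * q (n - k)) = 1 + c * real m" and m: "1 \<le> m" "m \<le> n" "n \<le> Suc m"
  then have "norm (\<Sum>k\<le>m. p k * q (n - k)) = (\<Sum>k\<le>m. b k)"
    by (simp add: sum_b)
  from norm_sum_eq_bound_imp_aligned[OF finite_atMost le this]
  obtain u where u: "norm u = 1" "\<And>k. k \<le> m \<Longrightarrow> p k * q (n - k) = of_real (b k) * u"
    by auto
  have "p 1 * q (n - 1) = of_real c * q n"
    using u(2)[of 0] u(2)[of 1] m p0 by (simp add: b_def)
  moreover have "norm (p 1) = c"
  proof -
    have "norm (p 1) * norm (q (n - 1)) = c"
      using arg_cong[OF u(2)[of 1], of norm] m u(1) c by (simp add: b_def norm_mult)
    then have "c \<le> norm (p 1)"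
      using q'[of "n - 1"] by (metis mult_left_le norm_ge_zero)
    then show ?thesis using p by (simp add: order_antisym)
  qed
  moreover have "norm (q 1) = 1"
  proof -
    have "norm (p (n - 1)) * norm (q 1) = b (n - 1)"
      using arg_cong[OF u(2)[of "n - 1"], of norm] m u(1) c q0 p0 by (simp add: b_def norm_mult)
    moreover have "norm (p (n - 1)) \<le> b (n - 1)" "b (n - 1) > 0"
      using p p0 c by (auto simp: b_def)
    ultimately have "b (n - 1) \<le> b (n - 1) * norm (q 1)"
      by (metis mult_right_mono norm_ge_zero)
    then show ?thesis
      using \<open>b (n - 1) > 0\<close> q'[of 1] by simp
  qed
  ultimately show "norm (p 1) = c \<and> norm (q 1) = 1 \<and> p 1 * q (n - 1) = of_real c * q n"
    by blast
qed

lemma convolution_geometric: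
  fixes p q :: "nat \<Rightarrow> complex"
  assumes "p 0 = 1" "\<And>k. k \<ge> 1 \<Longrightarrow> p k = of_real c * e ^ k" "\<And>k. q k = e ^ k" "m \<le> n"
  shows "(\<Sum>k\<le>m. p k * q (n - k)) = of_real (1 + c * real m) * e ^ n"
proof -
  have "p k * q (n - k) = (if k = 0 then 1 else of_real c) * e ^ n" if "k \<le> m" for k
    using assms that by (simp flip: power_add)
  then have "(\<Sum>k\<le>m. p k * q (n - k)) = (\<Sum>k\<le>m. (if k = 0 then 1 else of_real c) * e ^ n)"
    by simp
  then show ?thesis
    by (simp add: sum.atMost_shift algebra_simps)
qed

section \<open>The coefficients are determined by the mapping\<close>

lemma exp_series_log:
  assumes "exp_series_on_disc h a"
  obtains H where "H holomorphic_on unit_disc"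
    "H has_fps_expansion Abs_fps (\<lambda>n. if n = 0 then 0 else a n)"
    "\<And>z. norm z < 1 \<Longrightarrow> h z = exp (H z)" "H 0 = 0"
proof -
  define H where "H z = (\<Sum>n. a (Suc n) * z ^ Suc n)" for z
  have "(\<lambda>n. (if n = 0 then 0 else a n) * z ^ n) sums H z" if "norm z < 1" for z
  proof -
    have "(\<lambda>n. a (Suc n) * z ^ Suc n) sums H z"
      using assms that unfolding H_def exp_series_on_disc_def by (auto intro: summable_sums)
    then show ?thesis
      using sums_Suc_iff[of "\<lambda>n. (if n = 0 then 0 else a n) * z ^ n" "H z"] by simp
  qed
  note * = powser_on_disc[OF this]
  show ?thesis
    by (rule that[OF *]) (use assms in \<open>auto simp: H_def exp_series_on_disc_def\<close>)
qed

text \<open>The imaginary axis contains no nonempty open set, so by the open mapping theorem \<open>f\<close> is constant.\<close>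
lemma holomorphic_Re_zero_imp_zero:
  assumes hol: "f holomorphic_on unit_disc" and re: "\<And>z. norm z < 1 \<Longrightarrow> Re (f z) = 0" and "f 0 = 0"
    and z: "norm z < 1"
  shows "f z = 0"
proof -
  have "f constant_on unit_disc"
  proof (rule ccontr)
    assume "\<not> f constant_on unit_disc"
    then have "open (f ` unit_disc)"
      using hol by (intro open_mapping_thm[of f unit_disc]) auto
    moreover have "0 \<in> f ` unit_disc"
      using \<open>f 0 = 0\<close> by (force simp: image_iff)
    ultimately obtain r where r: "r > 0" "ball 0 r \<subseteq> f ` unit_disc"
      by (auto simp: open_contains_ball)
    then have "complex_of_real (r / 2) \<in> f ` unit_disc"
      by (auto simp: norm_divide)
    then obtain w where w: "norm w < 1" "f w = of_real (r / 2)"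
      by auto
    then show False using re[of w] r(1) by (metis Re_complex_of_real half_gt_zero less_irrefl)
  qed
  then show ?thesis
    using \<open>f 0 = 0\<close> z by (auto simp: constant_on_def)
qed

text \<open>Let \<open>U\<close> and \<open>V\<close> be the differences of the logarithms. Then \<open>exp U * cnj (exp V) = 1\<close>. Taking moduli
gives \<open>Re (U + V) = 0\<close>, hence \<open>V = - U\<close>; then \<open>exp U\<close> is real-valued, hence constantly \<open>1\<close>; then
\<open>Re U = 0\<close>, hence \<open>U = 0\<close>. Each step is an application of the preceding lemma.\<close>
lemma coefficients_unique:
  assumes ha: "exp_series_on_disc h a" and gb: "exp_series_on_disc g b"
    and ha': "exp_series_on_disc h' a'" and gb': "exp_series_on_disc g' b'"
    and eq: "\<forall>z\<in>unit_disc. z * h z * cnj (g z) = z * h' z * cnj (g' z)"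
    and n: "n \<ge> 1"
  shows "a n = a' n" and "b n = b' n"
proof -
  obtain H where H: "H holomorphic_on unit_disc"
    "H has_fps_expansion Abs_fps (\<lambda>n. if n = 0 then 0 else a n)"
    "\<And>z. norm z < 1 \<Longrightarrow> h z = exp (H z)" "H 0 = 0" using exp_series_log[OF ha] by blast
  obtain G where G: "G holomorphic_on unit_disc"
    "G has_fps_expansion Abs_fps (\<lambda>n. if n = 0 then 0 else b n)"
    "\<And>z. norm z < 1 \<Longrightarrow> g z = exp (G z)" "G 0 = 0" using exp_series_log[OF gb] by blast
  obtain H' where H': "H' holomorphic_on unit_disc"
    "H' has_fps_expansion Abs_fps (\<lambda>n. if n = 0 then 0 else a' n)"
    "\<And>z. norm z < 1 \<Longrightarrow> h' z = exp (H' z)" "H' 0 = 0" using exp_series_log[OF ha'] by blast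
  obtain G' where G': "G' holomorphic_on unit_disc"
    "G' has_fps_expansion Abs_fps (\<lambda>n. if n = 0 then 0 else b' n)"
    "\<And>z. norm z < 1 \<Longrightarrow> g' z = exp (G' z)" "G' 0 = 0" using exp_series_log[OF gb'] by blast
  define U where "U z = H z - H' z" for z
  define V where "V z = G z - G' z" for z
  have UV: "exp (U z) * cnj (exp (V z)) = 1" if z: "norm z < 1" for z
  proof (cases "z = 0")
    case True
    then show ?thesis by (simp add: U_def V_def H G H' G')
  next
    case False
    then show ?thesis
      using bspec[OF eq, of z] z by (simp add: U_def V_def exp_diff H(3)[OF z] G(3)[OF z] H'(3)[OF z] G'(3)[OF z])
  qed
  have holU: "U holomorphic_on unit_disc" and holV: "V holomorphic_on unit_disc"
    unfolding U_def V_def by (intro holomorphic_intros H G H' G')+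
  have "Re (U z + V z) = 0" if z: "norm z < 1" for z
  proof -
    have "exp (Re (U z) + Re (V z)) = 1"
      using arg_cong[OF UV[OF z], of norm] by (simp add: norm_mult exp_add)
    then show ?thesis by simp
  qed
  then have "U z + V z = 0" if "norm z < 1" for z
    using holomorphic_Re_zero_imp_zero[of "\<lambda>z. U z + V z" z] holU holV that
    by (simp add: holomorphic_on_add) (simp add: U_def V_def H G H' G')
  then have V: "V z = - U z" if "norm z < 1" for z
    using that by (simp add: add_eq_0_iff)
  have "Re (\<i> * (exp (U z) - 1)) = 0" if z: "norm z < 1" for z
  proof -
    have "exp (U z) = cnj (exp (U z))"
      using UV[OF z] V[OF z] by (simp add: exp_minus field_simps)
    then show ?thesis by (metis Reals_cnj_iff complex_is_Real_iff Re_i_times minus_zero minus_complex.sel(2) one_complex.sel(2) diff_zero)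
  qed
  moreover have "(\<lambda>z. \<i> * (exp (U z) - 1)) holomorphic_on unit_disc"
    by (intro holomorphic_intros holU)
  ultimately have "\<i> * (exp (U z) - 1) = 0" if "norm z < 1" for z
    using holomorphic_Re_zero_imp_zero[of "\<lambda>z. \<i> * (exp (U z) - 1)" z] that by (simp add: U_def H H')
  then have expU: "exp (U z) = 1" if "norm z < 1" for z
    using that by force
  have "Re (U z) = 0" if "norm z < 1" for z
    using expU[OF that] by (metis norm_exp_eq_Re norm_one exp_eq_one_iff)
  then have U0: "U z = 0" if "norm z < 1" for z
    using holomorphic_Re_zero_imp_zero[OF holU _ _ that] by (simp add: U_def H H')
  have near: "eventually (\<lambda>z. norm z < 1) (nhds (0::complex))"
    using eventually_nhds_in_open[of unit_disc "0::complex"] by simp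
  have "eventually (\<lambda>z. H z = H' z) (nhds 0)" "eventually (\<lambda>z. G z = G' z) (nhds 0)"
    using near U0 V by (auto elim!: eventually_mono simp: U_def V_def)
  then have "H' has_fps_expansion Abs_fps (\<lambda>n. if n = 0 then 0 else a n)"
    and "G' has_fps_expansion Abs_fps (\<lambda>n. if n = 0 then 0 else b n)"
    using H(2) G(2) has_fps_expansion_cong by blast+
  then have "Abs_fps (\<lambda>n. if n = 0 then 0 else a n) = Abs_fps (\<lambda>n. if n = 0 then 0 else a' n)"
    and "Abs_fps (\<lambda>n. if n = 0 then 0 else b n) = Abs_fps (\<lambda>n. if n = 0 then 0 else b' n)"
    using H'(2) G'(2) fps_expansion_unique_complex by blast+
  from this[THEN arg_cong, of "\<lambda>F. fps_nth F n"] show "a n = a' n" "b n = b' n"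
    using n by simp_all
qed

section \<open>The convolution formula for the coefficients\<close>

lemma wirtinger_mult_cnj:
  assumes "(u has_field_derivative u') (at z)" "(v has_field_derivative v') (at z)"
    and "open S" "z \<in> S" "\<And>w. w \<in> S \<Longrightarrow> f w = u w * cnj (v w)"
  shows "wirtinger_z f z = u' * cnj (v z)" and "wirtinger_zbar f z = u z * cnj v'"
proof -
  have "((\<lambda>w. u w * cnj (v w)) has_derivative
          (\<lambda>d. u z * cnj (v' * d) + u' * d * cnj (v z))) (at z)"
    using assms(1,2) unfolding has_field_derivative_def
    by (auto intro!: derivative_eq_intros)
  then have "(f has_derivative (\<lambda>d. u z * cnj (v' * d) + u' * d * cnj (v z))) (at z)"
    by (rule has_derivative_transform_within_open[OF _ assms(3,4)]) (simp add: assms(5))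
  then have "frechet_derivative f (at z) = (\<lambda>d. u z * cnj (v' * d) + u' * d * cnj (v z))"
    using frechet_derivative_at by metis
  then show "wirtinger_z f z = u' * cnj (v z)" "wirtinger_zbar f z = u z * cnj v'"
    by (simp_all add: wirtinger_z_def wirtinger_zbar_def algebra_simps)
qed

text \<open>Write \<open>h = exp H\<close>, \<open>g = exp G\<close>, \<open>A = 1 + z H'\<close> and \<open>B = z G'\<close>, so that \<open>z f\<^sub>z / f = A\<close> and
\<open>cnj z f\<^sub>z\<^sub>b\<^sub>a\<^sub>r / f = cnj B\<close>. The differential equation becomes \<open>B = \<mu> A\<close>, and starlikeness says that
\<open>p = A - B\<close> has real part greater than \<open>\<alpha>\<close>. Eliminating \<open>\<mu>\<close> through \<open>q = 1 / (1 - \<mu>)\<close> gives \<open>A = p q\<close>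
and \<open>B = p q - p\<close>. Subtracting \<open>p\<close> removes precisely the last term of the convolution, since
\<open>q 0 = 1\<close>; \<open>Re q > 1/2\<close> because \<open>w \<mapsto> 1 / (1 - w)\<close> maps the unit disc onto that half-plane.\<close>
lemma starlike_coefficients_convolution:
  assumes f: "f \<in> log_harmonic_starlike \<alpha>" and \<alpha>: "\<alpha> < 1"
    and fhg: "\<forall>z\<in>unit_disc. f z = z * h z * cnj (g z)"
    and ha: "exp_series_on_disc h a" and gb: "exp_series_on_disc g b"
  obtains p q P Q where
    "p holomorphic_on unit_disc" "p 0 = 1" "\<forall>z\<in>unit_disc. Re (p z) > \<alpha>" "p has_fps_expansion P"
    "q holomorphic_on unit_disc" "q 0 = 1" "\<forall>z\<in>unit_disc. Re (q z) > 1 / 2" "q has_fps_expansion Q"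
    "\<And>n. n \<ge> 1 \<Longrightarrow> of_nat n * a n = (\<Sum>k\<le>n. fps_nth P k * fps_nth Q (n - k))"
    "\<And>n. n \<ge> 1 \<Longrightarrow> of_nat n * b n = (\<Sum>k\<le>n - 1. fps_nth P k * fps_nth Q (n - k))"
proof -
  obtain H where H: "H holomorphic_on unit_disc"
    "H has_fps_expansion Abs_fps (\<lambda>n. if n = 0 then 0 else a n)"
    "\<And>z. norm z < 1 \<Longrightarrow> h z = exp (H z)" "H 0 = 0" using exp_series_log[OF ha] by blast
  obtain G where G: "G holomorphic_on unit_disc"
    "G has_fps_expansion Abs_fps (\<lambda>n. if n = 0 then 0 else b n)"
    "\<And>z. norm z < 1 \<Longrightarrow> g z = exp (G z)" "G 0 = 0" using exp_series_log[OF gb] by blast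
  obtain \<mu> where \<mu>: "log_harmonic_with_dilatation f \<mu>" "\<mu> 0 = 0"
    using f by (auto simp: log_harmonic_starlike_def)
  then have hol\<mu>: "\<mu> holomorphic_on unit_disc" and \<mu>1: "\<And>z. norm z < 1 \<Longrightarrow> norm (\<mu> z) < 1"
    by (auto simp: log_harmonic_with_dilatation_def)
  define A where "A z = 1 + z * deriv H z" for z
  define B where "B z = z * deriv G z" for z
  define p where "p z = A z - B z" for z
  define q where "q z = 1 / (1 - \<mu> z)" for z
  have hol: "A holomorphic_on unit_disc" "B holomorphic_on unit_disc" "p holomorphic_on unit_disc"
    unfolding A_def B_def p_def
    by (intro holomorphic_intros holomorphic_deriv H(1) G(1) open_ball)+
  have nz\<mu>: "1 - \<mu> z \<noteq> 0" if "norm z < 1" for z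
    using \<mu>1[OF that] by auto
  have holq: "q holomorphic_on unit_disc"
    unfolding q_def by (intro holomorphic_intros hol\<mu>) (use nz\<mu> in auto)
  have key: "B z = \<mu> z * A z \<and> Re (p z) > \<alpha>" if z: "norm z < 1" "z \<noteq> 0" for z
  proof -
    let ?E = "exp (H z)" and ?F = "exp (G z)"
    have dH: "(H has_field_derivative deriv H z) (at z)" and dG: "(G has_field_derivative deriv G z) (at z)"
      using z H(1) G(1) by (auto intro: holomorphic_derivI)
    have "((\<lambda>w. w * exp (H w)) has_field_derivative ?E * A z) (at z)"
      by (auto intro!: derivative_eq_intros dH simp: A_def algebra_simps)
    moreover have "((\<lambda>w. exp (G w)) has_field_derivative ?F * deriv G z) (at z)"
      by (auto intro!: derivative_eq_intros dG)
    moreover have "f w = w * exp (H w) * cnj (exp (G w))" if "w \<in> unit_disc" for w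
      using fhg H(3) G(3) that by simp
    ultimately have fz: "wirtinger_z f z = ?E * A z * cnj ?F"
      and fzbar: "wirtinger_zbar f z = z * ?E * cnj (?F * deriv G z)"
      using z wirtinger_mult_cnj[of "\<lambda>w. w * exp (H w)" _ z "\<lambda>w. exp (G w)" _ unit_disc f]
      by auto
    have f_eq: "f z = z * ?E * cnj ?F"
      using bspec[OF fhg, of z] H(3)[of z] G(3)[of z] z by simp
    then have "f z \<noteq> 0" using z by simp
    then have "cnj (wirtinger_zbar f z) / cnj (f z) = \<mu> z * (wirtinger_z f z / f z)"
      using \<mu>(1) z by (simp add: log_harmonic_with_dilatation_def)
    then have "B z = \<mu> z * A z"
      using z by (simp add: fz fzbar f_eq B_def field_simps)
    moreover have "Re ((z * wirtinger_z f z - cnj z * wirtinger_zbar f z) / f z) > \<alpha>"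
      using f z by (auto simp: log_harmonic_starlike_def)
    moreover have "(z * wirtinger_z f z - cnj z * wirtinger_zbar f z) / f z = A z - cnj (B z)"
      using z by (simp add: fz fzbar f_eq B_def field_simps)
    ultimately show ?thesis by (simp add: p_def)
  qed
  have p0: "p 0 = 1" and q0: "q 0 = 1"
    by (simp_all add: p_def q_def A_def B_def \<mu>)
  have B: "B z = \<mu> z * A z" if "norm z < 1" for z
    using key[OF that] \<mu>(2) by (cases "z = 0") (simp_all add: B_def)
  have ppos: "Re (p z) > \<alpha>" if "norm z < 1" for z
    using key[OF that] \<alpha> p0 by (cases "z = 0") simp_all
  have qpos: "Re (q z) > 1 / 2" if "norm z < 1" for z
  proof -
    have "norm (\<mu> z)^2 < 1"
      using \<mu>1[OF that] by (simp add: power_less_one_iff abs_square_less_1)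
    then have lt: "(1 - Re (\<mu> z))^2 + (Im (\<mu> z))^2 < 2 * (1 - Re (\<mu> z))"
      unfolding cmod_power2 by (simp add: power2_eq_square algebra_simps)
    have pos: "(1 - Re (\<mu> z))^2 + (Im (\<mu> z))^2 > 0"
      using nz\<mu>[OF that] by (auto simp: sum_power2_gt_zero_iff complex_eq_iff)
    have "Re (q z) = (1 - Re (\<mu> z)) / ((1 - Re (\<mu> z))^2 + (Im (\<mu> z))^2)"
      by (simp add: q_def Re_divide)
    then show ?thesis using lt pos by (simp add: pos_less_divide_eq)
  qed
  obtain P Q where P: "p has_fps_expansion P" and Q: "q has_fps_expansion Q"
    using hol holq has_fps_expansion_fps_expansion[of unit_disc] by (meson centre_in_ball open_ball zero_less_one)
  have Apq: "A z = p z * q z" if "norm z < 1" for z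
    using B[OF that] nz\<mu>[OF that] by (simp add: p_def q_def field_simps)
  have Bpq: "B z = p z * q z - p z" if "norm z < 1" for z
  proof -
    have "B z = A z - p z"
      by (simp add: p_def)
    also have "\<dots> = p z * q z - p z"
      by (simp only: Apq[OF that])
    finally show ?thesis .
  qed
  have near: "eventually (\<lambda>z. norm z < 1) (nhds (0::complex))"
    using eventually_nhds_in_open[of unit_disc "0::complex"] by simp
  have eqA: "eventually (\<lambda>z. A z = p z * q z) (nhds 0)"
    and eqB: "eventually (\<lambda>z. B z = p z * q z - p z) (nhds 0)"
    using near by (eventually_elim; simp add: Apq Bpq)+
  have "A has_fps_expansion 1 + fps_X * fps_deriv (Abs_fps (\<lambda>n. if n = 0 then 0 else a n))"
    unfolding A_def by (intro fps_expansion_intros H(2))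
  moreover have "A has_fps_expansion P * Q"
    using has_fps_expansion_cong[OF eqA refl] has_fps_expansion_mult[OF P Q] by blast
  ultimately have PA: "1 + fps_X * fps_deriv (Abs_fps (\<lambda>n. if n = 0 then 0 else a n)) = P * Q"
    by (rule fps_expansion_unique_complex)
  have "B has_fps_expansion fps_X * fps_deriv (Abs_fps (\<lambda>n. if n = 0 then 0 else b n))"
    unfolding B_def by (intro fps_expansion_intros G(2))
  moreover have "B has_fps_expansion P * Q - P"
    using has_fps_expansion_cong[OF eqB refl] has_fps_expansion_diff[OF has_fps_expansion_mult[OF P Q] P]
    by (rule iffD2)
  ultimately have PB: "fps_X * fps_deriv (Abs_fps (\<lambda>n. if n = 0 then 0 else b n)) = P * Q - P"
    by (rule fps_expansion_unique_complex)
  have Q0: "fps_nth Q 0 = 1"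
    using fps_nth_fps_expansion[OF Q, of 0] q0 by simp
  have PQ: "fps_nth (P * Q) n = (\<Sum>k\<le>n. fps_nth P k * fps_nth Q (n - k))" for n
    by (simp add: fps_mult_nth atMost_atLeast0)
  have "of_nat n * a n = (\<Sum>k\<le>n. fps_nth P k * fps_nth Q (n - k))" if "n \<ge> 1" for n
    using arg_cong[OF PA, of "\<lambda>F. fps_nth F n"] that unfolding PQ by (simp add: of_nat_diff)
  moreover have "of_nat n * b n = (\<Sum>k\<le>n - 1. fps_nth P k * fps_nth Q (n - k))" if "n \<ge> 1" for n
  proof -
    have "of_nat n * b n = (\<Sum>k\<le>n. fps_nth P k * fps_nth Q (n - k)) - fps_nth P n"
      using arg_cong[OF PB, of "\<lambda>F. fps_nth F n"] that unfolding fps_sub_nth PQ by (simp add: of_nat_diff)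
    then show ?thesis
      using that Q0 by (cases n) simp_all
  qed
  ultimately show ?thesis
    using ppos qpos by (intro that[OF hol(3) p0 _ P holq q0 _ Q]) auto
qed

section \<open>The extremal mapping\<close>

text \<open>The logarithmic coefficients of both factors of the rotated extremal mapping: \<open>d = 1\<close> gives those of
\<open>h\<close> and \<open>d = 2 \<alpha> - 1\<close> those of \<open>g\<close>. Correspondingly \<open>extremal_log\<close> is the sum of their series.\<close>
definition extremal_coeff :: "real \<Rightarrow> real \<Rightarrow> complex \<Rightarrow> nat \<Rightarrow> complex" where
  "extremal_coeff \<alpha> d e n = of_real (2 * (1 - \<alpha>) + d / real n) * e ^ n"

definition extremal_log :: "real \<Rightarrow> real \<Rightarrow> complex \<Rightarrow> complex" where
  "extremal_log \<alpha> d w = of_real (2 * (1 - \<alpha>)) * (w / (1 - w)) - of_real d * Ln (1 - w)"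

text \<open>The constant part of the coefficients contributes a geometric series and the part \<open>d / n\<close> the series of
the logarithm.\<close>
lemma extremal_coeff_sums:
  assumes e: "norm e = 1" and z: "norm z < 1"
  shows "(\<lambda>n. extremal_coeff \<alpha> d e (Suc n) * z ^ Suc n) sums extremal_log \<alpha> d (e * z)"
proof -
  define w where "w = e * z"
  have w: "norm w < 1" using e z by (simp add: w_def norm_mult)
  have "(\<lambda>n. - (w ^ n / of_nat n)) sums ln (1 - w)"
    using Ln_series'[of "- w"] w by simp
  then have "(\<lambda>n. - (w ^ Suc n / of_nat (Suc n))) sums ln (1 - w)"
    using sums_Suc_iff[of "\<lambda>n. - (w ^ n / of_nat n)" "ln (1 - w)"] by simp
  moreover have "(\<lambda>n. w * w ^ n) sums (w * (1 / (1 - w)))"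
    by (rule sums_mult[OF geometric_sums[OF w]])
  ultimately have "(\<lambda>n. of_real (2 * (1 - \<alpha>)) * (w * w ^ n) - of_real d * - (w ^ Suc n / of_nat (Suc n)))
      sums (of_real (2 * (1 - \<alpha>)) * (w * (1 / (1 - w))) - of_real d * ln (1 - w))"
    by (rule sums_diff[OF sums_mult sums_mult, rotated])
  moreover have "of_real (2 * (1 - \<alpha>)) * (w * w ^ n) - of_real d * - (w ^ Suc n / of_nat (Suc n))
      = extremal_coeff \<alpha> d e (Suc n) * z ^ Suc n" for n
    unfolding extremal_coeff_def w_def power_mult_distrib of_real_add of_real_divide of_real_of_nat_eq
    by (simp add: field_simps del: of_nat_Suc)
  ultimately show ?thesis
    by (simp add: extremal_log_def w_def)
qed

lemma exp_series_extremal: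
  assumes "norm e = 1"
  shows "exp_series_on_disc (\<lambda>z. exp (extremal_log \<alpha> d (e * z))) (extremal_coeff \<alpha> d e)"
  using extremal_coeff_sums[OF assms] unfolding exp_series_on_disc_def
  by (auto simp: sums_iff)

text \<open>The rational parts of the two logarithms agree; they combine to \<open>exp s * cnj (exp s) = \<bar>exp s\<bar>\<^sup>2\<close>, which is the
real exponential factor of the extremal mapping. The logarithmic parts give the two powers.\<close>
lemma rotated_extremal_eq:
  assumes e: "norm e = 1" and z: "norm z < 1"
  shows "cnj e * extremal_log_harmonic \<alpha> (e * z) =
           z * exp (extremal_log \<alpha> 1 (e * z)) * cnj (exp (extremal_log \<alpha> (2 * \<alpha> - 1) (e * z)))"
proof -
  define w where "w = e * z"
  define s where "s = of_real (2 * (1 - \<alpha>)) * (w / (1 - w))"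
  define L where "L = Ln (1 - w)"
  have w: "norm w < 1" using e z by (simp add: w_def norm_mult)
  have nz: "1 - w \<noteq> 0" using w by auto
  have "Re w < 1"
    using w complex_Re_le_cmod[of w] by linarith
  then have nonpos: "1 - w \<notin> \<real>\<^sub>\<le>\<^sub>0"
    by (simp add: complex_nonpos_Reals_iff)
  have "exp s * cnj (exp s) = of_real (exp (2 * Re s))"
    by (simp add: complex_norm_square[symmetric] exp_double del: exp_of_real)
  also have "2 * Re s = (1 - \<alpha>) * Re (4 * w / (1 - w))"
    unfolding s_def Re_complex_of_real Im_complex_of_real times_complex.sel
    by (simp add: Re_divide Im_divide field_simps)
  finally have ss: "exp s * cnj (exp s) = of_real (exp ((1 - \<alpha>) * Re (4 * w / (1 - w))))" .
  have "cnj (exp (of_real (2 * \<alpha> - 1) * L)) = (1 - cnj w) powr of_real (2 * \<alpha> - 1)"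
    using nz cnj_Ln[OF nonpos] by (simp add: powr_def exp_cnj L_def)
  then have G: "cnj (exp (s - of_real (2 * \<alpha> - 1) * L)) = cnj (exp s) / (1 - cnj w) powr of_real (2 * \<alpha> - 1)"
    by (simp only: exp_diff complex_cnj_divide)
  have H: "exp (s - L) = exp s / (1 - w)"
    using nz by (simp add: exp_diff L_def)
  have "cnj e * w = z"
    using e by (metis complex_norm_square mult.assoc mult.commute mult_1 of_real_1 power_one w_def)
  then show ?thesis
    unfolding extremal_log_harmonic_def extremal_log_def w_def[symmetric] s_def[symmetric] L_def[symmetric]
    unfolding G of_real_1 mult_1 H ss[symmetric] by (simp add: mult_ac)
qed

lemma extremal_imp_coeffs:
  assumes "\<forall>z\<in>unit_disc. f z = z * h z * cnj (g z)"
    and "exp_series_on_disc h a" and "exp_series_on_disc g b"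
    and "is_rotated_extremal \<alpha> f"
  obtains e where "norm e = 1" "\<And>n. n \<ge> 1 \<Longrightarrow> a n = extremal_coeff \<alpha> 1 e n"
    "\<And>n. n \<ge> 1 \<Longrightarrow> b n = extremal_coeff \<alpha> (2 * \<alpha> - 1) e n"
proof -
  obtain e where e: "norm e = 1" "\<And>z. z \<in> unit_disc \<Longrightarrow> f z = cnj e * extremal_log_harmonic \<alpha> (e * z)"
    using assms(4) by (auto simp: is_rotated_extremal_def)
  have eq: "\<forall>z\<in>unit_disc. z * h z * cnj (g z) =
      z * exp (extremal_log \<alpha> 1 (e * z)) * cnj (exp (extremal_log \<alpha> (2 * \<alpha> - 1) (e * z)))"
    using assms(1) e(2) rotated_extremal_eq[OF e(1), of _ \<alpha>] by (metis mem_ball_0)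
  note unique = coefficients_unique[OF assms(2,3) exp_series_extremal[OF e(1)] exp_series_extremal[OF e(1)] eq]
  show ?thesis
    by (intro that[OF e(1)] unique)
qed

text \<open>Coefficients that agree from index \<open>1\<close> on give equal sums, hence equal factors on the whole disc.\<close>
lemma coeffs_imp_extremal:
  assumes "\<forall>z\<in>unit_disc. f z = z * h z * cnj (g z)"
    and ha: "exp_series_on_disc h a" and gb: "exp_series_on_disc g b"
    and e: "norm e = 1" and a: "\<And>n. n \<ge> 1 \<Longrightarrow> a n = extremal_coeff \<alpha> 1 e n"
    and b: "\<And>n. n \<ge> 1 \<Longrightarrow> b n = extremal_coeff \<alpha> (2 * \<alpha> - 1) e n"
  shows "is_rotated_extremal \<alpha> f"
proof -
  have "f z = cnj e * extremal_log_harmonic \<alpha> (e * z)" if z: "norm z < 1" for z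
  proof -
    have "h z = exp (extremal_log \<alpha> 1 (e * z))" "g z = exp (extremal_log \<alpha> (2 * \<alpha> - 1) (e * z))"
      using ha gb z a b exp_series_extremal[OF e, of \<alpha>] by (simp_all add: exp_series_on_disc_def)
    then show ?thesis
      using bspec[OF assms(1), of z] z rotated_extremal_eq[OF e z, of \<alpha>] by simp
  qed
  with e show ?thesis by (auto simp: is_rotated_extremal_def)
qed

text \<open>The condition on \<open>d\<close> makes the real factor positive: \<open>2 (1 - \<alpha>) n + d \<ge> 2 (1 - \<alpha>) + (2 \<alpha> - 1) = 1\<close>.\<close>
lemma norm_extremal_coeff:
  assumes "\<alpha> < 1" "norm e = 1" "n \<ge> 1" "d \<ge> 2 * \<alpha> - 1"
  shows "norm (extremal_coeff \<alpha> d e n) = 2 * (1 - \<alpha>) + d / real n"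
proof -
  have "2 * (1 - \<alpha>) * 1 + (2 * \<alpha> - 1) \<le> 2 * (1 - \<alpha>) * real n + d"
    using assms by (intro add_mono mult_left_mono) auto
  then have "0 \<le> 2 * (1 - \<alpha>) * real n + d"
    by simp
  then have "0 \<le> (2 * (1 - \<alpha>) * real n + d) / real n"
    using assms by (intro divide_nonneg_nonneg) auto
  also have "\<dots> = 2 * (1 - \<alpha>) + d / real n"
    using assms by (simp add: field_simps)
  finally show ?thesis
    using assms by (simp only: extremal_coeff_def norm_mult norm_power norm_of_real) simp
qed

section \<open>Coefficient estimates and rigidity\<close>

lemma starlike_coeff_estimates:
  assumes f: "f \<in> log_harmonic_starlike \<alpha>" and \<alpha>: "\<alpha> < 1"
    and fhg: "\<forall>z\<in>unit_disc. f z = z * h z * cnj (g z)"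
    and ha: "exp_series_on_disc h a" and gb: "exp_series_on_disc g b"
  shows "n \<ge> 1 \<Longrightarrow> norm (a n) \<le> 2 * (1 - \<alpha>) + 1 / real n"
    and "n \<ge> 1 \<Longrightarrow> norm (b n) \<le> 2 * (1 - \<alpha>) + (2 * \<alpha> - 1) / real n"
    and "n \<ge> 1 \<Longrightarrow> norm (a n) = 2 * (1 - \<alpha>) + 1 / real n \<Longrightarrow> is_rotated_extremal \<alpha> f"
    and "n \<ge> 2 \<Longrightarrow> norm (b n) = 2 * (1 - \<alpha>) + (2 * \<alpha> - 1) / real n \<Longrightarrow> is_rotated_extremal \<alpha> f"
proof -
  obtain p q P Q where
    p: "p holomorphic_on unit_disc" "p 0 = 1" "\<forall>z\<in>unit_disc. Re (p z) > \<alpha>" "p has_fps_expansion P"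
    and q: "q holomorphic_on unit_disc" "q 0 = 1" "\<forall>z\<in>unit_disc. Re (q z) > 1 / 2" "q has_fps_expansion Q"
    and a: "\<And>n. n \<ge> 1 \<Longrightarrow> of_nat n * a n = (\<Sum>k\<le>n. fps_nth P k * fps_nth Q (n - k))"
    and b: "\<And>n. n \<ge> 1 \<Longrightarrow> of_nat n * b n = (\<Sum>k\<le>n - 1. fps_nth P k * fps_nth Q (n - k))"
    by (rule starlike_coefficients_convolution[OF f \<alpha> fhg ha gb]) (rule that, assumption+)
  define c where "c = 2 * (1 - \<alpha>)"
  have c: "c > 0" using \<alpha> by (simp add: c_def)
  note P = caratheodory_order_coeff[OF p(1,2) \<alpha> p(3,4), folded c_def]
  note Q = caratheodory_order_coeff[OF q(1,2) _ q(3,4), simplified]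
  have P_le: "\<forall>k\<ge>1. norm (fps_nth P k) \<le> c" and Q_le: "\<forall>k\<ge>1. norm (fps_nth Q k) \<le> 1"
    using P(1) Q(1) by auto
  have P0: "fps_nth P 0 = 1" and Q0: "fps_nth Q 0 = 1"
    using fps_nth_fps_expansion[OF p(4), of 0] fps_nth_fps_expansion[OF q(4), of 0] p(2) q(2) by auto
  note conv = convolution_norm_le[of "fps_nth P" "fps_nth Q" c, OF P0 Q0 P_le Q_le c]
  have a_bd: "2 * (1 - \<alpha>) + 1 / real n = (1 + c * real n) / real n"
    and b_bd: "2 * (1 - \<alpha>) + (2 * \<alpha> - 1) / real n = (1 + c * real (n - 1)) / real n" if "n \<ge> 1" for n
    using that by (simp_all add: c_def field_simps of_nat_diff)
  have na: "norm (a n) = norm (\<Sum>k\<le>n. fps_nth P k * fps_nth Q (n - k)) / real n"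
    and nb: "norm (b n) = norm (\<Sum>k\<le>n - 1. fps_nth P k * fps_nth Q (n - k)) / real n" if "n \<ge> 1" for n
    unfolding a[OF that, symmetric] b[OF that, symmetric] using that by (simp_all add: norm_mult)
  show "norm (a n) \<le> 2 * (1 - \<alpha>) + 1 / real n" if "n \<ge> 1"
    unfolding a_bd[OF that] na[OF that] by (intro divide_right_mono conv(1)) auto
  show "norm (b n) \<le> 2 * (1 - \<alpha>) + (2 * \<alpha> - 1) / real n" if "n \<ge> 1"
    unfolding b_bd[OF that] nb[OF that] by (intro divide_right_mono conv(1)) auto
  \<comment> \<open>Equality makes both coefficient sequences geometric, with ratios \<open>e\<close> and \<open>e'\<close>; the alignment
    relation forces \<open>e = e'\<close>, and then the convolution can be summed explicitly.\<close>
  have extremal: "is_rotated_extremal \<alpha> f"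
    if n: "1 \<le> m" "m \<le> n" "n \<le> Suc m" and eq: "norm (\<Sum>k\<le>m. fps_nth P k * fps_nth Q (n - k)) = 1 + c * real m"
    for m n
  proof -
    have 1: "norm (fps_nth P 1) = c" "norm (fps_nth Q 1) = 1"
      and link: "fps_nth P 1 * fps_nth Q (n - 1) = of_real c * fps_nth Q n"
      using conv(2)[OF eq n] by auto
    obtain e where e: "norm e = 1" "\<And>k. k \<ge> 1 \<Longrightarrow> fps_nth P k = of_real c * e ^ k"
      using P(2)[OF 1(1)] by blast
    obtain e' where e': "norm e' = 1" "\<And>k. k \<ge> 1 \<Longrightarrow> fps_nth Q k = e' ^ k"
      using Q(2) 1(2) by auto
    have Qe': "fps_nth Q k = e' ^ k" for k
      using e' Q0 by (cases k) auto
    have "e * e' ^ (n - 1) = e' * e' ^ (n - 1)"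
      using link e(2)[of 1] c n by (simp add: Qe' power_eq_if)
    moreover have "e' ^ (n - 1) \<noteq> 0"
      using e'(1) by auto
    ultimately have "e = e'"
      using mult_right_cancel by blast
    then have Qe: "fps_nth Q k = e ^ k" for k
      using Qe' by simp
    have "a k = extremal_coeff \<alpha> 1 e k" "b k = extremal_coeff \<alpha> (2 * \<alpha> - 1) e k" if k: "k \<ge> 1" for k
    proof -
      have "of_nat k * a k = of_real (1 + c * real k) * e ^ k"
        unfolding a[OF k] by (rule convolution_geometric[of "fps_nth P"]) (use P0 e(2) Qe in auto)
      then show "a k = extremal_coeff \<alpha> 1 e k"
        unfolding extremal_coeff_def a_bd[OF k] using k by (simp add: field_simps)
      have "of_nat k * b k = of_real (1 + c * real (k - 1)) * e ^ k"
        unfolding b[OF k] by (rule convolution_geometric[of "fps_nth P"]) (use P0 e(2) Qe in auto)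
      then show "b k = extremal_coeff \<alpha> (2 * \<alpha> - 1) e k"
        unfolding extremal_coeff_def b_bd[OF k] using k by (simp add: field_simps)
    qed
    then show ?thesis
      using coeffs_imp_extremal[OF fhg ha gb e(1)] by blast
  qed
  show "is_rotated_extremal \<alpha> f" if "n \<ge> 1" "norm (a n) = 2 * (1 - \<alpha>) + 1 / real n"
    using that extremal[of n n] unfolding a_bd[OF that(1)] na[OF that(1)] by simp
  show "is_rotated_extremal \<alpha> f" if n: "n \<ge> 2" "norm (b n) = 2 * (1 - \<alpha>) + (2 * \<alpha> - 1) / real n"
  proof -
    have "n \<ge> 1" using n by simp
    with n show ?thesis
      using extremal[of "n - 1" n] unfolding b_bd[OF \<open>n \<ge> 1\<close>] nb[OF \<open>n \<ge> 1\<close>] by simp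
  qed
qed

theorem theorem2p6:
  fixes \<alpha> :: real and f h g :: "complex \<Rightarrow> complex" and a b :: "nat \<Rightarrow> complex"
  assumes "0 \<le> \<alpha>" and "\<alpha> < 1"
    and "f \<in> log_harmonic_starlike \<alpha>"
    and "\<And>z. z \<in> unit_disc \<Longrightarrow> f z = z * h z * cnj (g z)"
    and "exp_series_on_disc h a" and "exp_series_on_disc g b"
  shows "(\<forall>n\<ge>1. norm (a n) \<le> 2 * (1 - \<alpha>) + 1 / real n \<and>
                 norm (b n) \<le> 2 * (1 - \<alpha>) + (2 * \<alpha> - 1) / real n) \<and>
         (\<forall>n\<ge>1. (norm (a n) = 2 * (1 - \<alpha>) + 1 / real n \<and>
                  norm (b n) = 2 * (1 - \<alpha>) + (2 * \<alpha> - 1) / real n)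
                 \<longleftrightarrow> is_rotated_extremal \<alpha> f) \<and>
         (\<forall>n\<ge>1. norm (a n) = 2 * (1 - \<alpha>) + 1 / real n \<longleftrightarrow> is_rotated_extremal \<alpha> f) \<and>
         (\<forall>n\<ge>2. norm (b n) = 2 * (1 - \<alpha>) + (2 * \<alpha> - 1) / real n \<longleftrightarrow> is_rotated_extremal \<alpha> f)"
proof -
  have fhg: "\<forall>z\<in>unit_disc. f z = z * h z * cnj (g z)"
    using assms(4) by blast
  note bounds = starlike_coeff_estimates[OF assms(3,2) fhg assms(5,6)]
  have equal: "norm (a n) = 2 * (1 - \<alpha>) + 1 / real n \<and>
      norm (b n) = 2 * (1 - \<alpha>) + (2 * \<alpha> - 1) / real n"
    if n: "n \<ge> 1" and ext: "is_rotated_extremal \<alpha> f" for n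
  proof -
    obtain e where "norm e = 1" "a n = extremal_coeff \<alpha> 1 e n"
      "b n = extremal_coeff \<alpha> (2 * \<alpha> - 1) e n"
      using extremal_imp_coeffs[OF fhg assms(5,6) ext] n by metis
    then show ?thesis
      using norm_extremal_coeff[OF assms(2) _ n] assms(2) by simp
  qed
  show ?thesis
  proof (intro conjI allI impI)
    fix n :: nat
    show "norm (a n) \<le> 2 * (1 - \<alpha>) + 1 / real n"
      and "norm (b n) \<le> 2 * (1 - \<alpha>) + (2 * \<alpha> - 1) / real n" if "1 \<le> n"
      using bounds(1,2)[OF that] by blast+
    show "(norm (a n) = 2 * (1 - \<alpha>) + 1 / real n \<and>
           norm (b n) = 2 * (1 - \<alpha>) + (2 * \<alpha> - 1) / real n) \<longleftrightarrow> is_rotated_extremal \<alpha> f"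
      and "norm (a n) = 2 * (1 - \<alpha>) + 1 / real n \<longleftrightarrow> is_rotated_extremal \<alpha> f" if "1 \<le> n"
      using bounds(3)[OF that] equal[OF that] by blast+
    show "norm (b n) = 2 * (1 - \<alpha>) + (2 * \<alpha> - 1) / real n \<longleftrightarrow> is_rotated_extremal \<alpha> f" if "2 \<le> n"
      using bounds(4)[OF that] equal[of n] that by auto
  qed
qed

end
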